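(* Let $G$ be a group and let $R$ be a left $s$-unital algebra with a nondegenerate product. Let $\alpha=(\{R_g\}_{g\in G},\{\alpha_g:R_{g^{-1}}\to R_g\}_{g\in G})$ be a globalizable partial action of $G$ on $R$ such that: (1) $R_g$ has a nondegenerate product for every $g\in G$; (2) for every $g\in G$ there exists $\sigma_g\in M(R)$ such that (i) $\sigma_g$ is a central idempotent in $M(R)$; (ii) $\alpha_g(\sigma_{g^{-1}}\sigma_h)=\sigma_g\sigma_{gh}$ for all $h\in G$; (iii) $\alpha_g(x)=\alpha_g(x)\sigma_g$ for all $x\in R_{g^{-1}}$; (iv) $R\sigma_g\subseteq R_g$. Then $R$ is a symmetric partial left $\hat{A}_G$-module algebra via $\varphi(\_\,\delta_g)\cdot x=\alpha_g(x\sigma_{g^{-1}})$ and $\mathfrak{e}:\hat{A}_G\to M(R)$ with $\mathfrak{e}(\varphi(\_\,\delta_g))=\sigma_g$, for all $g\in G$ and $x\in R$ (both extended linearly).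
   Context: All vector spaces and algebras are over a fixed field $\Bbbk$, $\otimes=\otimes_\Bbbk$; algebras are associative and not necessarily unital. An algebra $B$ has a nondegenerate product if ($ab=0$ for all $b\in B$ implies $a=0$) and ($ab=0$ for all $a\in B$ implies $b=0$). Its multiplier algebra $M(B)$ consists of the pairs $m=(U,V)$ of linear maps $B\to B$ with $V(a)b=aU(b)$ for all $a,b\in B$, with product $(U,V)(U',V')=(U\circ U',V'\circ V)$; write $mb=U(b)$, $bm=V(b)$. $R$ is left $s$-unital if $x\in Rx$ for every $x\in R$. Partial action of $G$ on $R$: bilateral ideals $R_g\subseteq R$ and algebra isomorphisms $\alpha_g:R_{g^{-1}}\to R_g$ such that (i) $R_{1_G}=R$ and $\alpha_{1_G}=\mathrm{id}_R$; (ii) $\alpha_h^{-1}(R_h\cap R_{g^{-1}})\subseteq R_{(gh)^{-1}}$; (iii) $\alpha_g(\alpha_h(x))=\alpha_{gh}(x)$ for $x\in\alpha_h^{-1}(R_h\cap R_{g^{-1}})$. It is globalizable if it admits a globalization: an action $\beta$ of $G$ on an algebra $T$ by automorphisms and a monomorphism $\psi:R\to T$ such that $\psi(R)$ is an ideal in $T$, $T=\sum_{g\in G}\beta_g(\psi(R))$, $\psi(R_g)=\psi(R)\cap\beta_g(\psi(R))$, and $\psi\circ\alpha_g=\beta_g\circ\psi$ on $R_{g^{-1}}$. In (2)(ii), $\alpha_g$ denotes the unique extension $M(R_{g^{-1}})\to M(R_g)$ of the isomorphism $\alpha_g$, and $\sigma_g\sigma_h\in M(R)$ is regarded, by restriction,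 as an element of $M(R_g)$. $A_G$ is the algebra (pointwise product) of finitely supported functions $G\to\Bbbk$, with basis $\delta_g$ ($\delta_g(h)=1$ if $g=h$, $0$ otherwise), a regular multiplier Hopf algebra with $\Delta(f)(p,q)=f(pq)$. $\varphi$ is the left integral on $A_G$ with $\varphi(\delta_g)=1$ for all $g$; $\varphi(\_\,\delta_g)$ is the functional $f\mapsto\varphi(f\delta_g)$. $\hat{A}_G$ is the dual, with basis $\{\varphi(\_\,\delta_g)\}_{g\in G}$; it is the Hopf algebra with $\varphi(\_\,\delta_g)\varphi(\_\,\delta_h)=\varphi(\_\,\delta_{gh})$, unit $\varphi(\_\,\delta_{1_G})$, each $\varphi(\_\,\delta_g)$ group-like, and antipode $\hat S(\varphi(\_\,\delta_g))=\varphi(\_\,\delta_{g^{-1}})$ (so $\hat A_G\cong\Bbbk G$). For $A$ a Hopf algebra with bijective antipode $S$ (here $A=\hat A_G$), a symmetric partial (left) $A$-module algebra is a triple $(R,\cdot,\mathfrak{e})$ with $R$ an algebra with nondegenerate product and linear maps $\cdot:A\otimes R\to R$, $\mathfrak{e}:A\to M(R)$ such that for all $a,b\in A$, $x,y\in R$ (Sweedler notation): (i) $a\cdot(x(b\cdot y))=(a_{(1)}\cdot x)(a_{(2)}b\cdot y)$; (ii) $\mathfrak{e}(a)(b\cdot x)=a_{(1)}\cdot(S(a_{(2)})b\cdot x)$ and $\mathfrak{e}(A)R\subseteq A\cdot R$; (iii) for $a_1,\dots,a_n\in A$, $x_1,\dots,x_m\in R$ there is $b\in A$ with $a_ib=a_i=ba_i$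 and $a_i\cdot x_j=a_i\cdot(b\cdot x_j)$ for all $i,j$; (iv) $A\cdot x=0$ iff $x=0$; (v) $a\cdot((b\cdot x)y)=(a_{(1)}b\cdot x)(a_{(2)}\cdot y)$; (vi) $(b\cdot x)\mathfrak{e}(a)=a_{(2)}\cdot(S^{-1}(a_{(1)})b\cdot x)$; (vii) $R\mathfrak{e}(A)\subseteq A\cdot R$. *)

theory Defs
  imports Complex_Main "HOL-Library.FuncSet" "HOL-Library.Poly_Mapping"
begin

section \<open>Algebras, ideals and multipliers\<close>

text \<open>The class \<open>ring\<close> is associative and has no unit.\<close>

locale assoc_algebra = vector_space scale
  for scale :: "'k::field \<Rightarrow> 'r::ring \<Rightarrow> 'r" +
  assumes scale_mult_left: "scale c (x * y) = scale c x * y"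
    and scale_mult_right: "scale c (x * y) = x * scale c y"

definition nondegenerate :: "'r::ring set \<Rightarrow> bool" where
  "nondegenerate B \<longleftrightarrow>
     (\<forall>a\<in>B. (\<forall>b\<in>B. a * b = 0) \<longrightarrow> a = 0) \<and> (\<forall>b\<in>B. (\<forall>a\<in>B. a * b = 0) \<longrightarrow> b = 0)"

definition left_s_unital :: "'r::ring set \<Rightarrow> bool" where
  "left_s_unital B \<longleftrightarrow> (\<forall>x\<in>B. x \<in> {r * x | r. r \<in> B})"

definition algebra_ideal :: "('k::field \<Rightarrow> 'r::ring \<Rightarrow> 'r) \<Rightarrow> 'r set \<Rightarrow> bool" where
  "algebra_ideal scale I \<longleftrightarrow>
     module.subspace scale I \<and> (\<forall>r. \<forall>x\<in>I. r * x \<in> I \<and> x * r \<in> I)"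

definition linear_on ::
  "('k \<Rightarrow> 'r::ring \<Rightarrow> 'r) \<Rightarrow> ('k \<Rightarrow> 's::ring \<Rightarrow> 's) \<Rightarrow> 'r set \<Rightarrow> ('r \<Rightarrow> 's) \<Rightarrow> bool" where
  "linear_on scale scale' B f \<longleftrightarrow>
     (\<forall>x\<in>B. \<forall>y\<in>B. f (x + y) = f x + f y) \<and> (\<forall>c. \<forall>x\<in>B. f (scale c x) = scale' c (f x))"

definition algebra_hom_on ::
  "('k \<Rightarrow> 'r::ring \<Rightarrow> 'r) \<Rightarrow> ('k \<Rightarrow> 's::ring \<Rightarrow> 's) \<Rightarrow> 'r set \<Rightarrow> ('r \<Rightarrow> 's) \<Rightarrow> bool" where
  "algebra_hom_on scale scale' B f \<longleftrightarrow>
     linear_on scale scale' B f \<and> (\<forall>x\<in>B. \<forall>y\<in>B. f (x * y) = f x * f y)"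

definition algebra_iso_on ::
  "('k \<Rightarrow> 'r::ring \<Rightarrow> 'r) \<Rightarrow> 'r set \<Rightarrow> 'r set \<Rightarrow> ('r \<Rightarrow> 'r) \<Rightarrow> bool" where
  "algebra_iso_on scale B C f \<longleftrightarrow> algebra_hom_on scale scale B f \<and> bij_betw f B C"

text \<open>
  A multiplier \<open>m = (U, V)\<close> acts by \<open>m b = U b\<close> and \<open>b m = V b\<close>. The maps of a multiplier
  of \<open>B\<close> are extensional, so that equality of pairs is equality in \<open>M(B)\<close>.
\<close>

type_synonym 'r multiplier = "('r \<Rightarrow> 'r) \<times> ('r \<Rightarrow> 'r)"

abbreviation mult_left :: "'r multiplier \<Rightarrow> 'r \<Rightarrow> 'r" where
  "mult_left m b \<equiv> fst m b"

abbreviation mult_right :: "'r \<Rightarrow> 'r multiplier \<Rightarrow> 'r" where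
  "mult_right b m \<equiv> snd m b"

definition multipliers ::
  "('k::field \<Rightarrow> 'r::ring \<Rightarrow> 'r) \<Rightarrow> 'r set \<Rightarrow> 'r multiplier set" where
  "multipliers scale B =
     {(U, V). U \<in> B \<rightarrow>\<^sub>E B \<and> V \<in> B \<rightarrow>\<^sub>E B \<and>
        linear_on scale scale B U \<and> linear_on scale scale B V \<and>
        (\<forall>a\<in>B. \<forall>b\<in>B. V a * b = a * U b)}"

definition multiplier_prod ::
  "'r set \<Rightarrow> 'r multiplier \<Rightarrow> 'r multiplier \<Rightarrow> 'r multiplier" where
  "multiplier_prod B m n = (compose B (fst m) (fst n), compose B (snd n) (snd m))"

definition central_idempotent_multiplier ::
  "('k::field \<Rightarrow> 'r::ring \<Rightarrow> 'r) \<Rightarrow> 'r set \<Rightarrow> 'r multiplier \<Rightarrow> bool" where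
  "central_idempotent_multiplier scale B m \<longleftrightarrow>
     m \<in> multipliers scale B \<and> multiplier_prod B m m = m \<and>
     (\<forall>n\<in>multipliers scale B. multiplier_prod B m n = multiplier_prod B n m)"

definition restrict_multiplier :: "'r set \<Rightarrow> 'r multiplier \<Rightarrow> 'r multiplier" where
  "restrict_multiplier B m = (restrict (fst m) B, restrict (snd m) B)"

definition inner_multiplier :: "'r::ring set \<Rightarrow> 'r \<Rightarrow> 'r multiplier" where
  "inner_multiplier B a = ((\<lambda>b\<in>B. a * b), (\<lambda>b\<in>B. b * a))"

text \<open>
  The extension of an isomorphism \<open>f : B \<rightarrow> C\<close> to \<open>M(B) \<rightarrow> M(C)\<close>. That this is an extension, and
  the only one, is shown by the lemmas that follow.
\<close>

definition extend_to_multipliers ::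
  "'r set \<Rightarrow> 'r set \<Rightarrow> ('r \<Rightarrow> 'r) \<Rightarrow> 'r multiplier \<Rightarrow> 'r multiplier" where
  "extend_to_multipliers B C f m =
     ((\<lambda>y\<in>C. f (fst m (inv_into B f y))), (\<lambda>y\<in>C. f (snd m (inv_into B f y))))"

lemma multiplier_mult:
  assumes m: "m \<in> multipliers scale B" and nd: "nondegenerate B"
    and cl: "\<And>x y. x \<in> B \<Longrightarrow> y \<in> B \<Longrightarrow> x * y \<in> B"
    and sub: "\<And>x y. x \<in> B \<Longrightarrow> y \<in> B \<Longrightarrow> x - y \<in> B"
    and a: "a \<in> B" and b: "b \<in> B"
  shows "fst m (a * b) = fst m a * b" "snd m (a * b) = a * snd m b"
proof -
  obtain U V where mUV: "m = (U, V)" by (cases m)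
  have U: "\<And>x. x \<in> B \<Longrightarrow> U x \<in> B" and V: "\<And>x. x \<in> B \<Longrightarrow> V x \<in> B"
    and eq: "\<And>x y. x \<in> B \<Longrightarrow> y \<in> B \<Longrightarrow> V x * y = x * U y"
    using m by (auto simp: mUV multipliers_def PiE_iff)
  have "c * (U (a * b) - U a * b) = 0" if "c \<in> B" for c
  proof -
    have "c * U (a * b) = V c * a * b" using eq[of c "a * b"] that a b cl by (simp add: mult.assoc)
    also have "\<dots> = c * (U a * b)" using eq[of c a] that a by (simp add: mult.assoc)
    finally show ?thesis by (simp add: right_diff_distrib)
  qed
  moreover have "U (a * b) - U a * b \<in> B" by (intro sub cl U a b)
  ultimately have "U (a * b) - U a * b = 0" using nd unfolding nondegenerate_def by blast
  then show "fst m (a * b) = fst m a * b" by (simp add: mUV)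
  have "(V (a * b) - a * V b) * c = 0" if "c \<in> B" for c
  proof -
    have "V (a * b) * c = a * (b * U c)" using eq[of "a * b" c] that a b cl by (simp add: mult.assoc)
    also have "\<dots> = a * V b * c" using eq[of b c] that b by (simp add: mult.assoc)
    finally show ?thesis by (simp add: left_diff_distrib)
  qed
  moreover have "V (a * b) - a * V b \<in> B" by (intro sub cl V a b)
  ultimately have "V (a * b) - a * V b = 0" using nd unfolding nondegenerate_def by blast
  then show "snd m (a * b) = a * snd m b" by (simp add: mUV)
qed

context
  fixes scale :: "'k::field \<Rightarrow> 'r::ring \<Rightarrow> 'r" and B C :: "'r set" and f :: "'r \<Rightarrow> 'r"
  assumes alg: "assoc_algebra scale"
    and B: "algebra_ideal scale B" "nondegenerate B"
    and C: "algebra_ideal scale C" "nondegenerate C"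
    and f: "algebra_iso_on scale B C f"
begin

interpretation assoc_algebra scale by (fact alg)

private lemma closed:
  "x \<in> B \<Longrightarrow> y \<in> B \<Longrightarrow> x * y \<in> B" "x \<in> B \<Longrightarrow> y \<in> B \<Longrightarrow> x - y \<in> B"
  "x \<in> B \<Longrightarrow> y \<in> B \<Longrightarrow> x + y \<in> B" "x \<in> B \<Longrightarrow> scale c x \<in> B"
  "x \<in> C \<Longrightarrow> y \<in> C \<Longrightarrow> x * y \<in> C" "x \<in> C \<Longrightarrow> y \<in> C \<Longrightarrow> x - y \<in> C"
  "x \<in> C \<Longrightarrow> y \<in> C \<Longrightarrow> x + y \<in> C" "x \<in> C \<Longrightarrow> scale c x \<in> C"
  using B(1) C(1)
  by (simp_all add: algebra_ideal_def subspace_diff subspace_add subspace_scale)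

private lemma f_facts:
  "x \<in> B \<Longrightarrow> f x \<in> C" "x \<in> B \<Longrightarrow> y \<in> B \<Longrightarrow> f (x + y) = f x + f y"
  "x \<in> B \<Longrightarrow> f (scale c x) = scale c (f x)" "x \<in> B \<Longrightarrow> y \<in> B \<Longrightarrow> f (x * y) = f x * f y"
  "x \<in> B \<Longrightarrow> inv_into B f (f x) = x"
  using f unfolding algebra_iso_on_def algebra_hom_on_def linear_on_def
  by (auto simp: bij_betw_def)

private lemma C_E: assumes "y \<in> C" obtains x where "x \<in> B" "y = f x"
  using assms f that unfolding algebra_iso_on_def bij_betw_def by blast

private lemma multE:
  assumes "m \<in> multipliers scale D"
  shows "x \<in> D \<Longrightarrow> fst m x \<in> D" "x \<in> D \<Longrightarrow> snd m x \<in> D"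
    "x \<in> D \<Longrightarrow> y \<in> D \<Longrightarrow> snd m x * y = x * fst m y"
    "x \<in> D \<Longrightarrow> y \<in> D \<Longrightarrow> fst m (x + y) = fst m x + fst m y"
    "x \<in> D \<Longrightarrow> y \<in> D \<Longrightarrow> snd m (x + y) = snd m x + snd m y"
    "x \<in> D \<Longrightarrow> fst m (scale c x) = scale c (fst m x)"
    "x \<in> D \<Longrightarrow> snd m (scale c x) = scale c (snd m x)"
    "fst m \<in> extensional D" "snd m \<in> extensional D"
  using assms by (auto simp: multipliers_def linear_on_def PiE_iff)

private lemma ext_simps:
  "x \<in> B \<Longrightarrow> fst (extend_to_multipliers B C f m) (f x) = f (fst m x)"
  "x \<in> B \<Longrightarrow> snd (extend_to_multipliers B C f m) (f x) = f (snd m x)"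
  by (simp_all add: extend_to_multipliers_def f_facts)

lemma extend_to_multipliers_mem:
  assumes m: "m \<in> multipliers scale B"
  shows "extend_to_multipliers B C f m \<in> multipliers scale C"
proof -
  let ?e = "extend_to_multipliers B C f m"
  have ext: "fst ?e \<in> extensional C" "snd ?e \<in> extensional C"
    by (simp_all add: extend_to_multipliers_def)
  have 1: "fst ?e y \<in> C \<and> snd ?e y \<in> C \<and> fst ?e (scale c y) = scale c (fst ?e y) \<and>
      snd ?e (scale c y) = scale c (snd ?e y)" if y: "y \<in> C" for y c
  proof -
    obtain x where x: "x \<in> B" "y = f x" using y by (rule C_E)
    show ?thesis using x f_facts(3)[OF x(1), of c, symmetric]
      by (simp add: ext_simps f_facts(1) multE[OF m] closed)
        (simp add: f_facts(3) multE[OF m])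
  qed
  have 2: "fst ?e (y + z) = fst ?e y + fst ?e z \<and> snd ?e (y + z) = snd ?e y + snd ?e z \<and>
      snd ?e y * z = y * fst ?e z" if y: "y \<in> C" and z: "z \<in> C" for y z
  proof -
    obtain x where x: "x \<in> B" "y = f x" using y by (rule C_E)
    obtain w where w: "w \<in> B" "z = f w" using z by (rule C_E)
    have p: "y + z = f (x + w)" using x w by (simp add: f_facts(2))
    have q: "snd ?e y * z = f (snd m x * w)" "y * fst ?e z = f (x * fst m w)"
      using x w by (simp_all add: ext_simps f_facts(4) multE(1,2)[OF m])
    have "fst ?e (y + z) = f (fst m (x + w))" "snd ?e (y + z) = f (snd m (x + w))"
      unfolding p using x w by (simp_all only: ext_simps closed)
    then show ?thesis unfolding q using x w
      by (simp add: ext_simps f_facts(2) multE[OF m])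
  qed
  have "(fst ?e, snd ?e) \<in> multipliers scale C"
    unfolding multipliers_def linear_on_def using 1 2 ext by (auto simp: PiE_iff)
  then show ?thesis by simp
qed

lemma extend_to_multipliers_prod:
  assumes "m \<in> multipliers scale B" "n \<in> multipliers scale B"
  shows "extend_to_multipliers B C f (multiplier_prod B m n) =
    multiplier_prod C (extend_to_multipliers B C f m) (extend_to_multipliers B C f n)"
proof (rule prod_eqI)
  show "fst (extend_to_multipliers B C f (multiplier_prod B m n)) =
    fst (multiplier_prod C (extend_to_multipliers B C f m) (extend_to_multipliers B C f n))"
  proof
    fix y
    show "fst (extend_to_multipliers B C f (multiplier_prod B m n)) y =
      fst (multiplier_prod C (extend_to_multipliers B C f m) (extend_to_multipliers B C f n)) y"
    proof (cases "y \<in> C")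
      case True
      then obtain x where x: "x \<in> B" "y = f x" by (rule C_E)
      show ?thesis using x True
        by (simp add: ext_simps multiplier_prod_def compose_def multE[OF assms(2)])
    qed (simp add: multiplier_prod_def compose_def extend_to_multipliers_def)
  qed
  show "snd (extend_to_multipliers B C f (multiplier_prod B m n)) =
    snd (multiplier_prod C (extend_to_multipliers B C f m) (extend_to_multipliers B C f n))"
  proof
    fix y
    show "snd (extend_to_multipliers B C f (multiplier_prod B m n)) y =
      snd (multiplier_prod C (extend_to_multipliers B C f m) (extend_to_multipliers B C f n)) y"
    proof (cases "y \<in> C")
      case True
      then obtain x where x: "x \<in> B" "y = f x" by (rule C_E)
      show ?thesis using x True
        by (simp add: ext_simps multiplier_prod_def compose_def multE[OF assms(1)])
    qed (simp add: multiplier_prod_def compose_def extend_to_multipliers_def)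
  qed
qed

lemma inner_multiplier_mem: "a \<in> B \<Longrightarrow> inner_multiplier B a \<in> multipliers scale B"
  by (auto simp: inner_multiplier_def multipliers_def linear_on_def closed mult.assoc
      distrib_left distrib_right scale_mult_left[symmetric] scale_mult_right[symmetric])

lemma extend_to_multipliers_inner:
  assumes a: "a \<in> B"
  shows "extend_to_multipliers B C f (inner_multiplier B a) = inner_multiplier C (f a)"
proof -
  have "f (a * inv_into B f y) = f a * y \<and> f (inv_into B f y * a) = y * f a" if y: "y \<in> C" for y
  proof -
    obtain x where "x \<in> B" "y = f x" using y by (rule C_E)
    then show ?thesis using a by (simp add: f_facts)
  qed
  moreover have "inv_into B f y \<in> B" if y: "y \<in> C" for y
  proof -
    obtain x where "x \<in> B" "y = f x" using y by (rule C_E)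
    then show ?thesis by (simp add: f_facts)
  qed
  ultimately show ?thesis
    by (auto simp: extend_to_multipliers_def inner_multiplier_def fun_eq_iff restrict_def)
qed

lemma extend_to_multipliers_unique:
  assumes mem: "\<And>m. m \<in> multipliers scale B \<Longrightarrow> F m \<in> multipliers scale C"
    and mult: "\<And>m n. m \<in> multipliers scale B \<Longrightarrow> n \<in> multipliers scale B \<Longrightarrow>
      F (multiplier_prod B m n) = multiplier_prod C (F m) (F n)"
    and ext: "\<And>a. a \<in> B \<Longrightarrow> F (inner_multiplier B a) = inner_multiplier C (f a)"
    and m: "m \<in> multipliers scale B"
  shows "F m = extend_to_multipliers B C f m"
proof -
  note Fm = multE[OF mem[OF m]]
  note em = multE[OF extend_to_multipliers_mem[OF m]]
  have 1: "fst (F m) (f a) = f (fst m a)" if a: "a \<in> B" for a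
  proof -
    have "multiplier_prod B m (inner_multiplier B a) = inner_multiplier B (fst m a)"
      using a multiplier_mult[OF m B(2) closed(1,2)]
      by (auto simp: multiplier_prod_def inner_multiplier_def compose_def fun_eq_iff
          restrict_def multE[OF m] )
    then have "multiplier_prod C (F m) (inner_multiplier C (f a)) = inner_multiplier C (f (fst m a))"
      using mult[OF m inner_multiplier_mem[OF a]] ext a multE(1)[OF m a] by simp
    then have "fst (multiplier_prod C (F m) (inner_multiplier C (f a))) c =
        fst (inner_multiplier C (f (fst m a))) c" if "c \<in> C" for c by simp
    then have "fst (F m) (f a * c) = f (fst m a) * c" if "c \<in> C" for c
      using that by (simp add: multiplier_prod_def inner_multiplier_def compose_def)
    then have "(fst (F m) (f a) - f (fst m a)) * c = 0" if "c \<in> C" for c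
      using that multiplier_mult(1)[OF mem[OF m] C(2) closed(5,6)] a f_facts(1)
      by (simp add: left_diff_distrib)
    moreover have "fst (F m) (f a) - f (fst m a) \<in> C"
      by (intro closed(6) Fm(1) f_facts(1) multE(1)[OF m] a)
    ultimately have "fst (F m) (f a) - f (fst m a) = 0"
      using C(2) unfolding nondegenerate_def by blast
    then show ?thesis by simp
  qed
  have 2: "snd (F m) (f a) = f (snd m a)" if a: "a \<in> B" for a
  proof -
    have "(snd (F m) (f a) - f (snd m a)) * c = 0" if c: "c \<in> C" for c
    proof -
      obtain b where b: "b \<in> B" "c = f b" using c by (rule C_E)
      have "snd (F m) (f a) * c = f a * f (fst m b)" using Fm(3) a b c f_facts(1) 1 by simp
      also have "\<dots> = f (snd m a) * c"
        using a b multE[OF m] f_facts(4)[of a "fst m b"] f_facts(4)[of "snd m a" b] by simp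
      finally show ?thesis by (simp add: left_diff_distrib)
    qed
    moreover have "snd (F m) (f a) - f (snd m a) \<in> C"
      by (intro closed(6) Fm(2) f_facts(1) multE(2)[OF m] a)
    ultimately have "snd (F m) (f a) - f (snd m a) = 0"
      using C(2) unfolding nondegenerate_def by blast
    then show ?thesis by simp
  qed
  show ?thesis
  proof (rule prod_eqI)
    show "fst (F m) = fst (extend_to_multipliers B C f m)"
      by (rule extensionalityI[OF Fm(8) em(8)]) (metis C_E 1 ext_simps(1))
    show "snd (F m) = snd (extend_to_multipliers B C f m)"
      by (rule extensionalityI[OF Fm(9) em(9)]) (metis C_E 2 ext_simps(2))
  qed
qed

end


section \<open>Partial actions of groups\<close>

text \<open>
  Groups are written additively, as in class \<open>group_add\<close>; they are not assumed to be commutative.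
\<close>

locale partial_action = assoc_algebra scale
  for scale :: "'k::field \<Rightarrow> 'r::ring \<Rightarrow> 'r" +
  fixes D :: "'g::group_add \<Rightarrow> 'r set" and \<alpha> :: "'g \<Rightarrow> 'r \<Rightarrow> 'r"
  assumes ideal: "algebra_ideal scale (D g)"
    and iso: "algebra_iso_on scale (D (- g)) (D g) (\<alpha> g)"
    and dom_unit: "D 0 = UNIV"
    and act_unit: "\<alpha> 0 = id"
    and dom_comp: "inv_into (D (- h)) (\<alpha> h) ` (D h \<inter> D (- g)) \<subseteq> D (- (g + h))"
    and act_comp: "x \<in> inv_into (D (- h)) (\<alpha> h) ` (D h \<inter> D (- g)) \<Longrightarrow>
      \<alpha> g (\<alpha> h x) = \<alpha> (g + h) x"

locale algebra_action = assoc_algebra scaleT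
  for scaleT :: "'k::field \<Rightarrow> 't::ring \<Rightarrow> 't" +
  fixes \<beta> :: "'g::group_add \<Rightarrow> 't \<Rightarrow> 't"
  assumes automorphism: "algebra_iso_on scaleT UNIV UNIV (\<beta> g)"
    and unit: "\<beta> 0 = id"
    and comp: "\<beta> (g + h) = \<beta> g \<circ> \<beta> h"

locale globalization = partial_action scale D \<alpha> + T: algebra_action scaleT \<beta>
  for scale :: "'k::field \<Rightarrow> 'r::ring \<Rightarrow> 'r" and D :: "'g::group_add \<Rightarrow> 'r set"
    and \<alpha> :: "'g \<Rightarrow> 'r \<Rightarrow> 'r" and scaleT :: "'k \<Rightarrow> 't::ring \<Rightarrow> 't" and \<beta> :: "'g \<Rightarrow> 't \<Rightarrow> 't" +
  fixes \<psi> :: "'r \<Rightarrow> 't"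
  assumes hom: "algebra_hom_on scale scaleT UNIV \<psi>"
    and inj: "inj \<psi>"
    and image_ideal: "algebra_ideal scaleT (range \<psi>)"
    and generates: "T.span (\<Union>g. \<beta> g ` range \<psi>) = UNIV"
    and image_dom: "\<psi> ` D g = range \<psi> \<inter> \<beta> g ` range \<psi>"
    and equivariant: "x \<in> D (- g) \<Longrightarrow> \<psi> (\<alpha> g x) = \<beta> g (\<psi> x)"

text \<open>
  HOL cannot quantify over the type carrying the enveloping algebra inside a formula, so that type
  is a parameter.
\<close>

definition globalizable ::
  "'t::ring itself \<Rightarrow> ('k::field \<Rightarrow> 'r::ring \<Rightarrow> 'r) \<Rightarrow> ('g::group_add \<Rightarrow> 'r set) \<Rightarrow>
    ('g \<Rightarrow> 'r \<Rightarrow> 'r) \<Rightarrow> bool" where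
  "globalizable _ scale D \<alpha> \<longleftrightarrow>
     (\<exists>(scaleT :: 'k \<Rightarrow> 't \<Rightarrow> 't) \<beta> \<psi>. globalization scale D \<alpha> scaleT \<beta> \<psi>)"


section \<open>Hopf algebras and symmetric partial module algebras\<close>

text \<open>
  The comultiplication sends \<open>a\<close> to a finite set of pairs \<open>(p, q)\<close> with
  \<open>\<Delta>(a) = \<Sum> p \<otimes> q\<close>, the sum over that set; a Sweedler expression \<open>F(a\<^sub>1, a\<^sub>2)\<close>, with \<open>F\<close> bilinear,
  is then the sum of \<open>F p q\<close> over \<open>\<Delta> a\<close>. Equations in the tensor powers of \<open>A\<close> are tested
  on multilinear forms, which separate the points of a tensor power over a field.
\<close>

definition bilinear_form ::
  "('k::field \<Rightarrow> 'a::ab_group_add \<Rightarrow> 'a) \<Rightarrow> ('a \<Rightarrow> 'a \<Rightarrow> 'k) \<Rightarrow> bool" where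
  "bilinear_form scale b \<longleftrightarrow>
     (\<forall>y. Vector_Spaces.linear scale (*) (\<lambda>x. b x y)) \<and>
     (\<forall>x. Vector_Spaces.linear scale (*) (\<lambda>y. b x y))"

definition trilinear_form ::
  "('k::field \<Rightarrow> 'a::ab_group_add \<Rightarrow> 'a) \<Rightarrow> ('a \<Rightarrow> 'a \<Rightarrow> 'a \<Rightarrow> 'k) \<Rightarrow> bool" where
  "trilinear_form scale t \<longleftrightarrow>
     (\<forall>y z. Vector_Spaces.linear scale (*) (\<lambda>x. t x y z)) \<and>
     (\<forall>x z. Vector_Spaces.linear scale (*) (\<lambda>y. t x y z)) \<and>
     (\<forall>x y. Vector_Spaces.linear scale (*) (\<lambda>z. t x y z))"

locale hopf_algebra = assoc_algebra scale
  for scale :: "'k::field \<Rightarrow> 'a::ring_1 \<Rightarrow> 'a" +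
  fixes \<Delta> :: "'a \<Rightarrow> ('a \<times> 'a) set" and \<epsilon> :: "'a \<Rightarrow> 'k" and S :: "'a \<Rightarrow> 'a"
  assumes comult_finite: "finite (\<Delta> a)"
    and comult_linear: "bilinear_form scale b \<Longrightarrow>
      Vector_Spaces.linear scale (*) (\<lambda>a. \<Sum>(p, q)\<in>\<Delta> a. b p q)"
    and comult_mult: "bilinear_form scale b \<Longrightarrow>
      (\<Sum>(p, q)\<in>\<Delta> (x * y). b p q) = (\<Sum>(p, q)\<in>\<Delta> x. \<Sum>(p', q')\<in>\<Delta> y. b (p * p') (q * q'))"
    and comult_one: "bilinear_form scale b \<Longrightarrow> (\<Sum>(p, q)\<in>\<Delta> 1. b p q) = b 1 1"
    and coassoc: "trilinear_form scale t \<Longrightarrow>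
      (\<Sum>(p, q)\<in>\<Delta> a. \<Sum>(u, v)\<in>\<Delta> p. t u v q) = (\<Sum>(p, q)\<in>\<Delta> a. \<Sum>(u, v)\<in>\<Delta> q. t p u v)"
    and counit_linear: "Vector_Spaces.linear scale (*) \<epsilon>"
    and counit_mult: "\<epsilon> (x * y) = \<epsilon> x * \<epsilon> y"
    and counit_one: "\<epsilon> 1 = 1"
    and counit_left: "(\<Sum>(p, q)\<in>\<Delta> a. scale (\<epsilon> p) q) = a"
    and counit_right: "(\<Sum>(p, q)\<in>\<Delta> a. scale (\<epsilon> q) p) = a"
    and antipode_linear: "Vector_Spaces.linear scale scale S"
    and antipode_left: "(\<Sum>(p, q)\<in>\<Delta> a. S p * q) = scale (\<epsilon> a) 1"
    and antipode_right: "(\<Sum>(p, q)\<in>\<Delta> a. p * S q) = scale (\<epsilon> a) 1"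

locale symmetric_partial_module_algebra =
  A: hopf_algebra scaleA \<Delta> \<epsilon> S + R: assoc_algebra scale
  for scaleA :: "'k::field \<Rightarrow> 'a::ring_1 \<Rightarrow> 'a" and \<Delta> :: "'a \<Rightarrow> ('a \<times> 'a) set"
    and \<epsilon> :: "'a \<Rightarrow> 'k" and S :: "'a \<Rightarrow> 'a" and scale :: "'k \<Rightarrow> 'r::ring \<Rightarrow> 'r" +
  fixes act :: "'a \<Rightarrow> 'r \<Rightarrow> 'r" and \<ee> :: "'a \<Rightarrow> 'r multiplier"
  assumes antipode_bij: "bij S"
    and nondeg: "nondegenerate (UNIV :: 'r set)"
    and act_linear_left: "Vector_Spaces.linear scaleA scale (\<lambda>a. act a x)"
    and act_linear_right: "Vector_Spaces.linear scale scale (act a)"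
    and e_multiplier: "\<ee> a \<in> multipliers scale UNIV"
    and e_linear_left: "Vector_Spaces.linear scaleA scale (\<lambda>a. mult_left (\<ee> a) x)"
    and e_linear_right: "Vector_Spaces.linear scaleA scale (\<lambda>a. mult_right x (\<ee> a))"
    and act_mult_left: "act a (x * act b y) = (\<Sum>(a1, a2)\<in>\<Delta> a. act a1 x * act (a2 * b) y)"
    and e_left: "mult_left (\<ee> a) (act b x) = (\<Sum>(a1, a2)\<in>\<Delta> a. act a1 (act (S a2 * b) x))"
    and e_left_subset: "R.span {mult_left (\<ee> a) x | a x. True} \<subseteq> R.span {act a x | a x. True}"
    and local_units: "finite P \<Longrightarrow> finite Q \<Longrightarrow>
      \<exists>b. (\<forall>a\<in>P. a * b = a \<and> b * a = a) \<and> (\<forall>a\<in>P. \<forall>x\<in>Q. act a x = act a (act b x))"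
    and act_faithful: "(\<forall>a. act a x = 0) \<longleftrightarrow> x = 0"
    and act_mult_right: "act a (act b x * y) = (\<Sum>(a1, a2)\<in>\<Delta> a. act (a1 * b) x * act a2 y)"
    and e_right: "mult_right (act b x) (\<ee> a) = (\<Sum>(a1, a2)\<in>\<Delta> a. act a2 (act (inv S a1 * b) x))"
    and e_right_subset: "R.span {mult_right x (\<ee> a) | a x. True} \<subseteq> R.span {act a x | a x. True}"


section \<open>The algebra \<open>A\<^sub>G\<close> and its dual\<close>

text \<open>
  The elements of \<open>A\<^sub>G\<close> are the finitely supported functions \<open>'g \<Rightarrow>\<^sub>0 'k\<close>. The product that the
  library declares on this type is convolution; the product of \<open>A\<^sub>G\<close> is \<open>AG_mult\<close>.
\<close>

lift_definition AG_mult :: "('g \<Rightarrow>\<^sub>0 'k::field) \<Rightarrow> ('g \<Rightarrow>\<^sub>0 'k) \<Rightarrow> 'g \<Rightarrow>\<^sub>0 'k"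
  is "\<lambda>f a g. f g * a g"
  by (rule finite_subset[rotated]) auto

abbreviation AG_delta :: "'g \<Rightarrow> 'g \<Rightarrow>\<^sub>0 'k::field" where
  "AG_delta g \<equiv> Poly_Mapping.single g 1"

definition AG_integral :: "('g \<Rightarrow>\<^sub>0 'k::field) \<Rightarrow> 'k" where
  "AG_integral f = (\<Sum>g\<in>Poly_Mapping.keys f. Poly_Mapping.lookup f g)"

typedef (overloaded) ('g, 'k) AG_dual =
  "range (\<lambda>a f. AG_integral (AG_mult f a)) :: (('g \<Rightarrow>\<^sub>0 'k::field) \<Rightarrow> 'k) set"
  morphisms dual_apply Abs_AG_dual
  by blast

definition integral_dual :: "('g \<Rightarrow>\<^sub>0 'k::field) \<Rightarrow> ('g, 'k) AG_dual" where
  "integral_dual a = Abs_AG_dual (\<lambda>f. AG_integral (AG_mult f a))"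

text \<open>The functional \<open>f \<mapsto> \<phi>(f \<delta>\<^sub>g)\<close>.\<close>

definition phi_delta :: "'g \<Rightarrow> ('g, 'k::field) AG_dual" where
  "phi_delta g = integral_dual (AG_delta g)"

lemma AG_integral_mult:
  assumes "finite K" "Poly_Mapping.keys a \<subseteq> K"
  shows "AG_integral (AG_mult f a) = (\<Sum>g\<in>K. Poly_Mapping.lookup f g * Poly_Mapping.lookup a g)"
proof -
  have "Poly_Mapping.keys (AG_mult f a) \<subseteq> K"
    using assms(2) by (auto simp: in_keys_iff AG_mult.rep_eq)
  then show ?thesis unfolding AG_integral_def AG_mult.rep_eq[symmetric]
    by (intro sum.mono_neutral_left assms) (auto simp: in_keys_iff)
qed

lemma dual_apply_integral_dual: "dual_apply (integral_dual a) f = AG_integral (AG_mult f a)"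
  unfolding integral_dual_def by (subst Abs_AG_dual_inverse) auto

lemma dual_apply_integral_dual_delta [simp]: "dual_apply (integral_dual a) (AG_delta g) = Poly_Mapping.lookup a g"
  by (subst dual_apply_integral_dual, subst AG_integral_mult[of "insert g (Poly_Mapping.keys a)"])
    (auto simp: lookup_single when_def if_distrib[of "\<lambda>x. x * _"] cong: if_cong)

lemma dual_apply_phi_delta: "dual_apply (phi_delta g) f = Poly_Mapping.lookup f g"
  unfolding phi_delta_def by (subst dual_apply_integral_dual, subst AG_integral_mult[of "{g}"]) auto

lemma AG_dual_cases: obtains a where "\<omega> = integral_dual a"
  using that unfolding integral_dual_def by (cases \<omega>) auto

definition coeffs :: "('g, 'k::field) AG_dual \<Rightarrow> 'g \<Rightarrow>\<^sub>0 'k" where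
  "coeffs \<omega> = (SOME a. \<omega> = integral_dual a)"

lemma integral_dual_coeffs: "integral_dual (coeffs \<omega>) = \<omega>"
  unfolding coeffs_def by (metis (mono_tags) AG_dual_cases someI)

lemma lookup_coeffs: "Poly_Mapping.lookup (coeffs \<omega>) g = dual_apply \<omega> (AG_delta g)"
  by (metis dual_apply_integral_dual_delta integral_dual_coeffs)

lemma AG_dual_eqI: "(\<And>g. dual_apply \<omega> (AG_delta g) = dual_apply \<omega>' (AG_delta g)) \<Longrightarrow> \<omega> = \<omega>'"
  by (metis integral_dual_coeffs lookup_coeffs poly_mapping_eqI)

definition dual_support :: "('g, 'k::field) AG_dual \<Rightarrow> 'g set" where
  "dual_support \<omega> = {g. dual_apply \<omega> (AG_delta g) \<noteq> 0}"

lemma dual_support_keys: "dual_support \<omega> = Poly_Mapping.keys (coeffs \<omega>)"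
  by (auto simp: dual_support_def in_keys_iff lookup_coeffs)

lemma finite_dual_support [simp]: "finite (dual_support \<omega>)"
  by (simp add: dual_support_keys)

lemma dual_apply_expand:
  assumes "finite K" "dual_support \<omega> \<subseteq> K"
  shows "dual_apply \<omega> f = (\<Sum>g\<in>K. Poly_Mapping.lookup f g * dual_apply \<omega> (AG_delta g))"
proof -
  have "dual_apply \<omega> f = AG_integral (AG_mult f (coeffs \<omega>))"
    by (metis dual_apply_integral_dual integral_dual_coeffs)
  then show ?thesis using assms by (simp add: AG_integral_mult dual_support_keys lookup_coeffs)
qed

lemma in_AG_dualI:
  assumes "finite K" "\<And>f. h f = (\<Sum>g\<in>K. Poly_Mapping.lookup f g * c g)"
  shows "h \<in> range (\<lambda>a f. AG_integral (AG_mult f a))"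
proof -
  have fin: "finite {g. (if g \<in> K then c g else 0) \<noteq> 0}"
    by (rule finite_subset[OF _ assms(1)]) auto
  define a where "a = Abs_poly_mapping (\<lambda>g. if g \<in> K then c g else 0)"
  have l: "Poly_Mapping.lookup a g = (if g \<in> K then c g else 0)" for g using fin by (simp add: a_def)
  have "h = (\<lambda>f. AG_integral (AG_mult f a))"
    by (rule ext, subst AG_integral_mult[OF assms(1)])
      (auto simp: assms(2) l in_keys_iff split: if_splits)
  then show ?thesis by blast
qed

setup_lifting type_definition_AG_dual

instantiation AG_dual :: (type, field) ab_group_add
begin

lift_definition zero_AG_dual :: "('a, 'b) AG_dual" is "\<lambda>_. 0"
  by (rule in_AG_dualI[of "{}"]) auto

lift_definition plus_AG_dual :: "('a, 'b) AG_dual \<Rightarrow> ('a, 'b) AG_dual \<Rightarrow> ('a, 'b) AG_dual"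
  is "\<lambda>u v f. u f + v f"
  subgoal premises p for u v
  proof -
    obtain a b where "u = (\<lambda>f. AG_integral (AG_mult f a))" "v = (\<lambda>f. AG_integral (AG_mult f b))"
      using p by blast
    then show ?thesis
      by (intro in_AG_dualI[of "Poly_Mapping.keys a \<union> Poly_Mapping.keys b" _ "\<lambda>g. Poly_Mapping.lookup a g + Poly_Mapping.lookup b g"])
        (simp_all add: AG_integral_mult[of "Poly_Mapping.keys a \<union> Poly_Mapping.keys b"] sum.distrib distrib_left)
  qed
  done

lift_definition uminus_AG_dual :: "('a, 'b) AG_dual \<Rightarrow> ('a, 'b) AG_dual" is "\<lambda>u f. - u f"
  subgoal premises p for u
  proof -
    obtain a where "u = (\<lambda>f. AG_integral (AG_mult f a))" using p by blast
    then show ?thesis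
      by (intro in_AG_dualI[of "Poly_Mapping.keys a" _ "\<lambda>g. - Poly_Mapping.lookup a g"])
        (simp_all add: AG_integral_mult[of "Poly_Mapping.keys a"] sum_negf)
  qed
  done

definition minus_AG_dual :: "('a, 'b) AG_dual \<Rightarrow> ('a, 'b) AG_dual \<Rightarrow> ('a, 'b) AG_dual" where
  "minus_AG_dual u v = u + (- v)"

instance
  by standard (transfer, auto simp: minus_AG_dual_def fun_eq_iff)+

end

lift_definition dual_scale :: "'k::field \<Rightarrow> ('g, 'k) AG_dual \<Rightarrow> ('g, 'k) AG_dual" is "\<lambda>c u f. c * u f"
  subgoal premises p for c u
  proof -
    obtain a where "u = (\<lambda>f. AG_integral (AG_mult f a))" using p by blast
    then show ?thesis
      by (intro in_AG_dualI[of "Poly_Mapping.keys a" _ "\<lambda>g. c * Poly_Mapping.lookup a g"])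
        (simp_all add: AG_integral_mult[of "Poly_Mapping.keys a"] sum_distrib_left mult.left_commute)
  qed
  done

lemma dual_apply_sum: "dual_apply (sum F K) f = (\<Sum>i\<in>K. dual_apply (F i) f)"
  by (induction K rule: infinite_finite_induct) (simp_all add: zero_AG_dual.rep_eq plus_AG_dual.rep_eq)

lemma coeffs_eqI: "coeffs u = coeffs v \<Longrightarrow> u = v"
  by (metis integral_dual_coeffs)

lemma coeffs_plus: "coeffs (u + v) = coeffs u + coeffs v"
  by (rule poly_mapping_eqI) (simp add: lookup_coeffs lookup_add plus_AG_dual.rep_eq)

lemma coeffs_zero: "coeffs 0 = 0"
  by (rule poly_mapping_eqI) (simp add: lookup_coeffs zero_AG_dual.rep_eq)

lemma dual_expand:
  assumes "finite K" "dual_support \<omega> \<subseteq> K"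
  shows "\<omega> = (\<Sum>g\<in>K. dual_scale (dual_apply \<omega> (AG_delta g)) (phi_delta g))"
  by (rule AG_dual_eqI, subst dual_apply_expand[OF assms])
    (simp add: dual_apply_sum dual_scale.rep_eq dual_apply_phi_delta mult.commute)

lemma poly_mapping_expand:
  "(\<Sum>g\<in>Poly_Mapping.keys a. Poly_Mapping.single g (Poly_Mapping.lookup a g)) = a"
  by (rule poly_mapping_eqI) (auto simp: lookup_sum lookup_single when_def in_keys_iff)

lemma poly_mapping_mult_expand:
  fixes a b :: "'g::group_add \<Rightarrow>\<^sub>0 'k::field"
  shows "a * b = (\<Sum>g\<in>Poly_Mapping.keys a. \<Sum>h\<in>Poly_Mapping.keys b.
    Poly_Mapping.single (g + h) (Poly_Mapping.lookup a g * Poly_Mapping.lookup b h))"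
proof -
  have "a * b = (\<Sum>g\<in>Poly_Mapping.keys a. Poly_Mapping.single g (Poly_Mapping.lookup a g)) *
      (\<Sum>h\<in>Poly_Mapping.keys b. Poly_Mapping.single h (Poly_Mapping.lookup b h))"
    by (simp only: poly_mapping_expand)
  then show ?thesis by (simp only: sum_product mult_single)
qed

text \<open>
  Every \<open>\<omega>\<close> is the sum of the \<open>\<omega>(\<delta>\<^sub>g) \<phi>(_ \<delta>\<^sub>g)\<close>; the operations below are the linear extensions
  of \<open>\<phi>(_ \<delta>\<^sub>g) \<phi>(_ \<delta>\<^sub>h) = \<phi>(_ \<delta>\<^sub>g\<^sub>h)\<close>, of \<open>\<phi>(_ \<delta>\<^sub>g) \<mapsto> \<phi>(_ \<delta>\<^sub>g) \<otimes> \<phi>(_ \<delta>\<^sub>g)\<close>, and so on.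
\<close>

instantiation AG_dual :: (group_add, field) ring_1
begin

definition one_AG_dual :: "('a, 'b) AG_dual" where
  "one_AG_dual = phi_delta 0"

definition times_AG_dual :: "('a, 'b) AG_dual \<Rightarrow> ('a, 'b) AG_dual \<Rightarrow> ('a, 'b) AG_dual" where
  "times_AG_dual u v =
     (\<Sum>g\<in>dual_support u. \<Sum>h\<in>dual_support v.
        dual_scale (dual_apply u (AG_delta g) * dual_apply v (AG_delta h)) (phi_delta (g + h)))"

lemma coeffs_times: "coeffs (u * v) = coeffs u * coeffs (v :: ('a, 'b) AG_dual)"
proof -
  have "Poly_Mapping.lookup (coeffs (u * v)) k = Poly_Mapping.lookup (coeffs u * coeffs v) k" for k
    unfolding poly_mapping_mult_expand lookup_sum lookup_coeffs times_AG_dual_def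
      dual_apply_sum dual_scale.rep_eq dual_apply_phi_delta dual_support_keys
    by (intro sum.cong refl) (auto simp: lookup_single when_def)
  then show ?thesis by (rule poly_mapping_eqI)
qed

lemma coeffs_one: "coeffs 1 = (1 :: 'a \<Rightarrow>\<^sub>0 'b)"
  by (rule poly_mapping_eqI)
    (simp add: lookup_coeffs one_AG_dual_def dual_apply_phi_delta lookup_single lookup_one
      when_def)

instance
proof
  fix u v w :: "('a, 'b) AG_dual"
  note c = coeffs_times coeffs_one coeffs_plus
  show "u * v * w = u * (v * w)" by (rule coeffs_eqI) (simp add: c mult.assoc)
  show "1 * u = u" by (rule coeffs_eqI) (simp add: c)
  show "u * 1 = u" by (rule coeffs_eqI) (simp add: c)
  show "(u + v) * w = u * w + v * w" by (rule coeffs_eqI) (simp add: c distrib_right)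
  show "u * (v + w) = u * v + u * w" by (rule coeffs_eqI) (simp add: c distrib_left)
  have "coeffs (0 :: ('a, 'b) AG_dual) \<noteq> coeffs 1"
    by (simp add: coeffs_one coeffs_zero)
  then show "(0 :: ('a, 'b) AG_dual) \<noteq> 1" by metis
qed

end

definition dual_comult ::
  "('g::group_add, 'k::field) AG_dual \<Rightarrow> (('g, 'k) AG_dual \<times> ('g, 'k) AG_dual) set" where
  "dual_comult \<omega> =
     (\<lambda>g. (dual_scale (dual_apply \<omega> (AG_delta g)) (phi_delta g), phi_delta g)) ` dual_support \<omega>"

definition dual_counit :: "('g::group_add, 'k::field) AG_dual \<Rightarrow> 'k" where
  "dual_counit \<omega> = (\<Sum>g\<in>dual_support \<omega>. dual_apply \<omega> (AG_delta g))"

definition dual_antipode :: "('g::group_add, 'k::field) AG_dual \<Rightarrow> ('g, 'k) AG_dual" where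
  "dual_antipode \<omega> =
     (\<Sum>g\<in>dual_support \<omega>. dual_scale (dual_apply \<omega> (AG_delta g)) (phi_delta (- g)))"

lemma phi_delta_mult: "phi_delta g * phi_delta h = (phi_delta (g + h) :: ('g::group_add, 'k::field) AG_dual)"
proof -
  have "dual_support (phi_delta x :: ('g, 'k) AG_dual) = {x}" for x
    by (auto simp: dual_support_def dual_apply_phi_delta lookup_single when_def)
  moreover have "dual_scale 1 u = u" for u :: "('g, 'k) AG_dual" by transfer simp
  ultimately show ?thesis by (simp add: times_AG_dual_def dual_apply_phi_delta)
qed

lemma dual_support_phi_delta [simp]: "dual_support (phi_delta x :: ('g, 'k::field) AG_dual) = {x}"
  by (auto simp: dual_support_def dual_apply_phi_delta lookup_single when_def)

lemma phi_delta_inj: "(phi_delta x :: ('g, 'k::field) AG_dual) = phi_delta y \<Longrightarrow> x = y"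
  by (drule arg_cong[where f = dual_support]) simp

lemma coeffs_scale: "coeffs (dual_scale c u) = Poly_Mapping.single 0 c * coeffs (u :: ('g::group_add, 'k::field) AG_dual)"
  by (rule poly_mapping_eqI)
    (simp add: lookup_coeffs dual_scale.rep_eq mult_map_scale_conv_mult[symmetric]
      map.rep_eq when_def)

interpretation dual: assoc_algebra "dual_scale :: 'k::field \<Rightarrow> ('g::group_add, 'k) AG_dual \<Rightarrow> _"
proof
  fix c d :: 'k and u v :: "('g, 'k) AG_dual"
  show "dual_scale c (u + v) = dual_scale c u + dual_scale c v" by transfer (simp add: distrib_left)
  show "dual_scale (c + d) u = dual_scale c u + dual_scale d u" by transfer (simp add: distrib_right)
  show "dual_scale c (dual_scale d u) = dual_scale (c * d) u" by transfer (simp add: mult.assoc)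
  show "dual_scale 1 u = u" by transfer simp
  show "dual_scale c (u * v) = dual_scale c u * v"
    by (rule coeffs_eqI) (simp add: coeffs_scale coeffs_times mult.assoc)
  have comm: "Poly_Mapping.single 0 c * a = a * Poly_Mapping.single 0 c" for a :: "'g \<Rightarrow>\<^sub>0 'k"
    by (cases "c = 0")
      (simp_all add: poly_mapping_mult_expand[of a] poly_mapping_mult_expand[of _ a] mult.commute)
  show "dual_scale c (u * v) = u * dual_scale c v"
    by (rule coeffs_eqI) (simp only: coeffs_scale coeffs_times mult.assoc[symmetric] comm[of "coeffs u"])
qed

lemma dual_linear_ext:
  fixes c :: "'g::group_add \<Rightarrow> 'v::ab_group_add" and sV :: "'k::field \<Rightarrow> 'v \<Rightarrow> 'v"
  assumes "vector_space sV"
  shows "Vector_Spaces.linear dual_scale sV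
    (\<lambda>\<omega>. \<Sum>g\<in>dual_support \<omega>. sV (dual_apply \<omega> (AG_delta g)) (c g))"
proof -
  interpret V: vector_space sV by fact
  have e: "(\<Sum>g\<in>dual_support \<omega>. sV (dual_apply \<omega> (AG_delta g)) (c g)) =
      (\<Sum>g\<in>K. sV (dual_apply \<omega> (AG_delta g)) (c g))"
    if "finite K" "dual_support \<omega> \<subseteq> K" for \<omega> K
    by (rule sum.mono_neutral_left[OF that]) (auto simp: dual_support_def)
  show ?thesis
  proof (intro_locales, unfold_locales)
    fix u v :: "('g, 'k) AG_dual" and r :: 'k
    let ?K = "dual_support u \<union> dual_support v"
    have sub: "dual_support (u + v) \<subseteq> ?K" "dual_support u \<subseteq> ?K" "dual_support v \<subseteq> ?K"
      by (auto simp: dual_support_def plus_AG_dual.rep_eq)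
    have fin: "finite ?K" by simp
    show "(\<Sum>g\<in>dual_support (u + v). sV (dual_apply (u + v) (AG_delta g)) (c g)) =
      (\<Sum>g\<in>dual_support u. sV (dual_apply u (AG_delta g)) (c g)) +
      (\<Sum>g\<in>dual_support v. sV (dual_apply v (AG_delta g)) (c g))"
      unfolding e[OF fin sub(1)] e[OF fin sub(2)] e[OF fin sub(3)]
      by (simp add: plus_AG_dual.rep_eq V.scale_left_distrib sum.distrib)
    have sub': "dual_support (dual_scale r u) \<subseteq> dual_support u"
      by (auto simp: dual_support_def dual_scale.rep_eq)
    show "(\<Sum>g\<in>dual_support (dual_scale r u). sV (dual_apply (dual_scale r u) (AG_delta g)) (c g)) =
      sV r (\<Sum>g\<in>dual_support u. sV (dual_apply u (AG_delta g)) (c g))"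
      unfolding e[OF finite_dual_support sub'] by (simp add: dual_scale.rep_eq V.scale_sum_right)
  qed
qed

lemma sum_dual_comult:
  fixes \<omega> :: "('g::group_add, 'k::field) AG_dual"
  shows "(\<Sum>(p, q)\<in>dual_comult \<omega>. F p q) =
    (\<Sum>g\<in>dual_support \<omega>. F (dual_scale (dual_apply \<omega> (AG_delta g)) (phi_delta g)) (phi_delta g))"
proof -
  have "inj_on (\<lambda>g. (dual_scale (dual_apply \<omega> (AG_delta g)) (phi_delta g), phi_delta g :: ('g, 'k) AG_dual))
    (dual_support \<omega>)"
    by (rule inj_onI) (auto dest: phi_delta_inj)
  then show ?thesis by (simp add: dual_comult_def sum.reindex)
qed

lemma linear_mult_scale: "Vector_Spaces.linear s (*) f \<Longrightarrow> f (s c x) = c * f x"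
  unfolding Vector_Spaces.linear_iff by blast

lemma sum_dual_comult_bilinear:
  assumes "bilinear_form dual_scale b"
  shows "(\<Sum>(p, q)\<in>dual_comult \<omega>. b p q) =
    (\<Sum>g\<in>dual_support \<omega>. dual_apply \<omega> (AG_delta g) * b (phi_delta g) (phi_delta g))"
proof -
  have "b (dual_scale c u) v = c * b u v" for c u v
    by (rule linear_mult_scale[of _ "\<lambda>x. b x v"]) (use assms in \<open>simp add: bilinear_form_def\<close>)
  then show ?thesis by (simp add: sum_dual_comult)
qed

lemma vector_space_field: "vector_space ((*) :: 'k::field \<Rightarrow> 'k \<Rightarrow> 'k)"
  by unfold_locales (simp_all add: algebra_simps)

lemma dual_comult_linear:
  assumes "bilinear_form dual_scale b"
  shows "Vector_Spaces.linear dual_scale (*) (\<lambda>\<omega>. \<Sum>(p, q)\<in>dual_comult \<omega>. b p q)"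
  unfolding sum_dual_comult_bilinear[OF assms] by (rule dual_linear_ext[OF vector_space_field])

lemma dual_comult_phi_delta:
  "dual_comult (phi_delta g) = {(phi_delta g, phi_delta g :: ('g::group_add, 'k::field) AG_dual)}"
  by (simp add: dual_comult_def dual_apply_phi_delta)

lemma dual_antipode_linear:
  "Vector_Spaces.linear dual_scale dual_scale (dual_antipode :: ('g::group_add, 'k::field) AG_dual \<Rightarrow> _)"
  unfolding dual_antipode_def by (rule dual_linear_ext) unfold_locales

lemma dual_antipode_phi_delta: "dual_antipode (phi_delta g) = phi_delta (- g)"
  by (simp add: dual_antipode_def dual_apply_phi_delta)

lemma dual_counit_linear: "Vector_Spaces.linear dual_scale (*) dual_counit"
  unfolding dual_counit_def using dual_linear_ext[OF vector_space_field, of "\<lambda>_. 1"] by simp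

lemma dual_counit_phi_delta [simp]: "dual_counit (phi_delta g) = 1"
  by (simp add: dual_counit_def dual_apply_phi_delta)

lemma dual_antipode_bij: "bij (dual_antipode :: ('g::group_add, 'k::field) AG_dual \<Rightarrow> _)"
proof -
  interpret S: Vector_Spaces.linear dual_scale dual_scale "dual_antipode :: ('g, 'k) AG_dual \<Rightarrow> _"
    by (rule dual_antipode_linear)
  have "dual_antipode (dual_antipode \<omega>) = \<omega>" for \<omega> :: "('g, 'k) AG_dual"
  proof -
    have "dual_antipode (dual_antipode \<omega>) =
        (\<Sum>g\<in>dual_support \<omega>. dual_scale (dual_apply \<omega> (AG_delta g)) (phi_delta g))"
      by (subst (2) dual_antipode_def) (simp add: S.sum S.scale dual_antipode_phi_delta)
    then show ?thesis by (simp add: dual_expand[symmetric])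
  qed
  then show ?thesis by (rule involuntory_imp_bij)
qed

lemma dual_hopf_algebra:
  "hopf_algebra (dual_scale :: 'k::field \<Rightarrow> ('g::group_add, 'k) AG_dual \<Rightarrow> _)
     dual_comult dual_counit dual_antipode"
proof -
  interpret eps: Vector_Spaces.linear dual_scale "(*)" "dual_counit :: ('g, 'k) AG_dual \<Rightarrow> 'k"
    by (rule dual_counit_linear)
  interpret S: Vector_Spaces.linear dual_scale dual_scale "dual_antipode :: ('g, 'k) AG_dual \<Rightarrow> _"
    by (rule dual_antipode_linear)
  note sc = dual.scale_mult_left[symmetric] dual.scale_mult_right[symmetric] phi_delta_mult
  have one: "1 = (phi_delta 0 :: ('g, 'k) AG_dual)" by (rule one_AG_dual_def)
  have scale_one: "(\<Sum>g\<in>dual_support a. dual_scale (dual_apply a (AG_delta g)) 1) =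
      dual_scale (dual_counit a) 1" for a :: "('g, 'k) AG_dual"
    by (simp add: dual_counit_def dual.scale_sum_left)
  show ?thesis
  proof (intro hopf_algebra.intro hopf_algebra_axioms.intro)
    show "assoc_algebra (dual_scale :: 'k \<Rightarrow> ('g, 'k) AG_dual \<Rightarrow> _)"
      by (rule dual.assoc_algebra_axioms)
    fix a x y :: "('g, 'k) AG_dual"
    show "finite (dual_comult a)" by (simp add: dual_comult_def)
    show "Vector_Spaces.linear dual_scale (*) dual_counit" by (rule dual_counit_linear)
    show "Vector_Spaces.linear dual_scale dual_scale (dual_antipode :: ('g, 'k) AG_dual \<Rightarrow> _)"
      by (rule dual_antipode_linear)
    show "dual_counit (x * y) = dual_counit x * dual_counit y"
      unfolding times_AG_dual_def by (simp add: eps.sum eps.scale) (simp add: dual_counit_def sum_product)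
    show "dual_counit (1 :: ('g, 'k) AG_dual) = 1" by (simp add: one)
    show "(\<Sum>(p, q)\<in>dual_comult a. dual_scale (dual_counit p) q) = a"
      by (simp add: sum_dual_comult eps.scale dual_expand[symmetric])
    show "(\<Sum>(p, q)\<in>dual_comult a. dual_scale (dual_counit q) p) = a"
      by (simp add: sum_dual_comult dual_expand[symmetric])
    show "(\<Sum>(p, q)\<in>dual_comult a. dual_antipode p * q) = dual_scale (dual_counit a) 1"
      by (simp add: sum_dual_comult S.scale dual_antipode_phi_delta sc one[symmetric] scale_one)
    show "(\<Sum>(p, q)\<in>dual_comult a. p * dual_antipode q) = dual_scale (dual_counit a) 1"
      by (simp add: sum_dual_comult dual_antipode_phi_delta sc one[symmetric] scale_one)
    fix b :: "('g, 'k) AG_dual \<Rightarrow> ('g, 'k) AG_dual \<Rightarrow> 'k"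
    assume b: "bilinear_form dual_scale b"
    show "Vector_Spaces.linear dual_scale (*) (\<lambda>a. \<Sum>(p, q)\<in>dual_comult a. b p q)"
      by (rule dual_comult_linear[OF b])
    have b1: "b (dual_scale c u) v = c * b u v" for c u v
      by (rule linear_mult_scale[of _ "\<lambda>x. b x v"]) (use b in \<open>simp add: bilinear_form_def\<close>)
    show "(\<Sum>(p, q)\<in>dual_comult 1. b p q) = b 1 1" by (simp add: one dual_comult_phi_delta)
    define E where "E = (\<lambda>a. \<Sum>(p, q)\<in>dual_comult a. b p q)"
    interpret E: Vector_Spaces.linear dual_scale "(*)" E
      unfolding E_def by (rule dual_comult_linear[OF b])
    have E_phi: "E (phi_delta g) = b (phi_delta g) (phi_delta g)" for g
      by (simp add: E_def dual_comult_phi_delta)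
    have "E (x * y) = (\<Sum>g\<in>dual_support x. \<Sum>h\<in>dual_support y.
        dual_apply x (AG_delta g) * dual_apply y (AG_delta h) * b (phi_delta (g + h)) (phi_delta (g + h)))"
      unfolding times_AG_dual_def by (simp only: E.sum E.scale E_phi)
    also have "\<dots> = (\<Sum>(p, q)\<in>dual_comult x. \<Sum>(p', q')\<in>dual_comult y. b (p * p') (q * q'))"
      by (subst sum_dual_comult, subst sum_dual_comult)
        (simp only: sc b1 dual.scale_scale mult.assoc mult.left_commute)
    finally show "(\<Sum>(p, q)\<in>dual_comult (x * y). b p q) =
      (\<Sum>(p, q)\<in>dual_comult x. \<Sum>(p', q')\<in>dual_comult y. b (p * p') (q * q'))"
      unfolding E_def .
  next
    fix a and t :: "('g, 'k) AG_dual \<Rightarrow> ('g, 'k) AG_dual \<Rightarrow> ('g, 'k) AG_dual \<Rightarrow> 'k"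
    assume t: "trilinear_form dual_scale t"
    have b: "bilinear_form dual_scale (\<lambda>u v. t u v q)" for q
      using t by (simp add: trilinear_form_def bilinear_form_def)
    have t1: "t (dual_scale c u) v w = c * t u v w" for c u v w
      by (rule linear_mult_scale[of _ "\<lambda>x. t x v w"]) (use t in \<open>simp add: trilinear_form_def\<close>)
    have D: "(\<Sum>(u, v)\<in>dual_comult (dual_scale c p). t u v q) = c * (\<Sum>(u, v)\<in>dual_comult p. t u v q)"
      for c p q by (rule linear_mult_scale[OF dual_comult_linear[OF b]])
    show "(\<Sum>(p, q)\<in>dual_comult a. \<Sum>(u, v)\<in>dual_comult p. t u v q) =
      (\<Sum>(p, q)\<in>dual_comult a. \<Sum>(u, v)\<in>dual_comult q. t p u v)"
      by (subst (1 2) sum_dual_comult) (simp add: D dual_comult_phi_delta t1)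
  qed
qed

end

theory Submission
  imports Defs
begin

text \<open>
  Each \<open>\<sigma>\<^sub>g\<close> acts on both sides by one idempotent bimodule map \<open>p\<^sub>g\<close>, and (iii) and (iv) say that
  \<open>R\<^sub>g = p\<^sub>g(R)\<close>; in particular \<open>p\<^sub>1 = id\<close>. Put \<open>a\<^sub>g = \<alpha>\<^sub>g \<circ> p\<^bsub>g\<^sup>-\<^sup>1\<^esub>\<close>. Condition (ii) becomes
  \<open>a\<^sub>g \<circ> p\<^sub>h = p\<^bsub>gh\<^esub> \<circ> a\<^sub>g\<close>, and with the composition law of the partial action it yields
  \<open>a\<^sub>g \<circ> a\<^sub>h = p\<^sub>g \<circ> a\<^bsub>gh\<^esub>\<close>. As \<open>a\<^sub>g\<close> is multiplicative, this gives every axiom on group-like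
  elements, and the rest is linear extension.
\<close>

section \<open>Linear extension from the group-like basis\<close>

definition dual_extend ::
  "('k::field \<Rightarrow> 'v::ab_group_add \<Rightarrow> 'v) \<Rightarrow> ('g::group_add \<Rightarrow> 'v) \<Rightarrow> ('g, 'k) AG_dual \<Rightarrow> 'v" where
  "dual_extend sV c \<omega> = (\<Sum>g\<in>dual_support \<omega>. sV (dual_apply \<omega> (AG_delta g)) (c g))"

lemma dual_extend_linear:
  "vector_space sV \<Longrightarrow> Vector_Spaces.linear dual_scale sV (dual_extend sV c)"
  unfolding dual_extend_def by (rule dual_linear_ext)

lemma dual_extend_phi_delta: "vector_space sV \<Longrightarrow> dual_extend sV c (phi_delta g) = c g"
  by (simp add: dual_extend_def dual_apply_phi_delta vector_space.vector_space_assms(4))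

text \<open>Reduces an identity linear in one argument to the group-like basis. The scalar sits
  inside the last case, so closure of \<open>P\<close> under scaling needs no case of its
  own.\<close>

lemma AG_dual_induct [case_names zero add scaled]:
  assumes "P 0" and "\<And>u v. P u \<Longrightarrow> P v \<Longrightarrow> P (u + v)"
    and "\<And>c g. P (dual_scale c (phi_delta g))"
  shows "P (\<omega> :: ('g::group_add, 'k::field) AG_dual)"
proof -
  have "P (\<Sum>g\<in>K. dual_scale (dual_apply \<omega> (AG_delta g)) (phi_delta g))" for K
    using assms by (induction K rule: infinite_finite_induct) auto
  then show ?thesis using dual_expand[OF finite_dual_support order_refl, of \<omega>] by metis
qed

lemma inv_dual_antipode_phi_delta:
  "inv dual_antipode (phi_delta g :: ('g::group_add, 'k::field) AG_dual) = phi_delta (- g)"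
  by (rule inv_f_eq[OF bij_is_inj[OF dual_antipode_bij]]) (simp add: dual_antipode_phi_delta)

lemma inv_dual_antipode_scale:
  \<comment> \<open>\<open>dual_comult\<close> puts the coefficient into the first leg, exactly
    where \<open>e_right\<close> applies the inverse antipode; this pulls it out again.\<close>
  "inv dual_antipode (dual_scale c u :: ('g::group_add, 'k::field) AG_dual) =
    dual_scale c (inv dual_antipode u)"
proof (rule inv_f_eq[OF bij_is_inj[OF dual_antipode_bij]])
  have "dual_antipode (dual_scale c (inv dual_antipode u)) =
      dual_scale c (dual_antipode (inv dual_antipode u))"
    using dual_antipode_linear unfolding Vector_Spaces.linear_iff by blast
  then show "dual_antipode (dual_scale c (inv dual_antipode u)) = dual_scale c u"
    by (simp add: surj_f_inv_f[OF bij_is_surj[OF dual_antipode_bij]])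
qed


section \<open>Partial representations by endomorphisms and projections\<close>

text \<open>Isolates what the module axioms use: \<open>a\<close> is multiplicative and composes
  like a group up to the projections \<open>p\<close>, and \<open>p_balanced\<close> makes the pair
  (\<open>p g\<close>, \<open>p g\<close>) a multiplier.\<close>

locale multiplicative_partial_representation = assoc_algebra scale
  for scale :: "'k::field \<Rightarrow> 'r::ring \<Rightarrow> 'r" +
  fixes a p :: "'g::group_add \<Rightarrow> 'r \<Rightarrow> 'r"
  assumes nondegenerate: "nondegenerate (UNIV :: 'r set)"
    and a_linear: "Vector_Spaces.linear scale scale (a g)"
    and p_linear: "Vector_Spaces.linear scale scale (p g)"
    and a_zero: "a 0 x = x"
    and a_mult: "a g (x * y) = a g x * a g y"
    and a_a: "a g (a h x) = p g (a (g + h) x)"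
    and p_a: "p g (a g x) = a g x"
    and p_balanced: "p g x * y = x * p g y"
begin

definition act :: "('g, 'k) AG_dual \<Rightarrow> 'r \<Rightarrow> 'r" where
  "act \<omega> x = dual_extend scale (\<lambda>g. a g x) \<omega>"

definition proj :: "('g, 'k) AG_dual \<Rightarrow> 'r \<Rightarrow> 'r" where
  "proj \<omega> x = dual_extend scale (\<lambda>g. p g x) \<omega>"

lemma act_phi_delta: "act (phi_delta g) x = a g x"
  by (simp add: act_def dual_extend_phi_delta vector_space_axioms)

lemma proj_phi_delta: "proj (phi_delta g) x = p g x"
  by (simp add: proj_def dual_extend_phi_delta vector_space_axioms)

lemma a_add: "a g (x + y) = a g x + a g y" and a_scale: "a g (scale c x) = scale c (a g x)"
  using a_linear unfolding Vector_Spaces.linear_iff by blast+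

lemma p_add: "p g (x + y) = p g x + p g y" and p_scale: "p g (scale c x) = scale c (p g x)"
  using p_linear unfolding Vector_Spaces.linear_iff by blast+

lemma act_linear_left: "Vector_Spaces.linear dual_scale scale (\<lambda>\<omega>. act \<omega> x)"
  unfolding act_def by (rule dual_extend_linear) (rule vector_space_axioms)

lemma proj_linear_left: "Vector_Spaces.linear dual_scale scale (\<lambda>\<omega>. proj \<omega> x)"
  unfolding proj_def by (rule dual_extend_linear) (rule vector_space_axioms)

lemma act_left:
  "act (u + v) x = act u x + act v x" "act (dual_scale c u) x = scale c (act u x)"
  using act_linear_left[of x] unfolding Vector_Spaces.linear_iff by blast+

lemma act_right:
  "act \<omega> (x + y) = act \<omega> x + act \<omega> y" "act \<omega> (scale c x) = scale c (act \<omega> x)"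
  by (simp_all add: act_def dual_extend_def a_add a_scale scale_right_distrib sum.distrib
      scale_sum_right mult.commute)

lemma proj_right:
  "proj \<omega> (x + y) = proj \<omega> x + proj \<omega> y" "proj \<omega> (scale c x) = scale c (proj \<omega> x)"
  by (simp_all add: proj_def dual_extend_def p_add p_scale scale_right_distrib sum.distrib
      scale_sum_right mult.commute)

lemma act_zero: "act 0 x = 0" "act \<omega> 0 = 0"
  using act_left(1)[of 0 0 x] act_right(1)[of \<omega> 0 0] by simp_all

lemma act_one: "act 1 x = x"
  by (simp add: one_AG_dual_def act_phi_delta a_zero)

lemmas act_simps = act_left act_right act_zero act_phi_delta a_a a_mult
  distrib_left distrib_right scale_right_distrib
  dual.scale_mult_left[symmetric] dual.scale_mult_right[symmetric] phi_delta_mult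
  scale_mult_left[symmetric] scale_mult_right[symmetric]

lemma a_p_zero: "a g 0 = 0" "p g 0 = 0"
  using a_add[of g 0 0] p_add[of g 0 0] by simp_all

text \<open>Balancedness moves \<open>p g\<close> onto the other factor, which it fixes. So a
  projection created by \<open>a_a\<close> is absorbed next to \<open>a g x\<close>.\<close>

lemma a_times_p: "a g x * p g y = a g x * y"
  by (simp add: p_balanced[symmetric] p_a)

lemma p_times_a: "p g y * a g x = y * a g x"
  by (simp add: p_balanced p_a)

text \<open>For \<open>b = phi_delta h\<close>, \<open>a_a\<close> turns the second factor into
  \<open>p g (a (g + h) y)\<close> and \<open>a_times_p\<close> removes the projection.\<close>

lemma a_mult_act: "a g (x * act b y) = a g x * act (phi_delta g * b) y"
  by (induction b rule: AG_dual_induct)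
    (simp_all add: act_simps a_add a_scale a_p_zero a_times_p)

lemma a_act_mult: "a g (act b x * y) = act (phi_delta g * b) x * a g y"
  by (induction b rule: AG_dual_induct)
    (simp_all add: act_simps a_add a_scale a_p_zero p_times_a)

text \<open>Serves both \<open>e_left\<close> and \<open>e_right\<close>, because the antipode and
  its inverse agree on group-likes. For \<open>b = phi_delta h\<close> it is \<open>a_a\<close> at
  \<open>g\<close> and \<open>- g + h\<close>.\<close>

lemma a_act_inverse: "a g (act (phi_delta (- g) * b) x) = p g (act b x)"
  by (induction b rule: AG_dual_induct)
    (simp_all add: act_simps a_add a_scale p_add p_scale a_p_zero add.assoc[symmetric])

theorem symmetric_partial_module_algebra:
  "symmetric_partial_module_algebra dual_scale dual_comult dual_counit dual_antipode scale act
    (\<lambda>\<omega>. (proj \<omega>, proj \<omega>))"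
proof (intro symmetric_partial_module_algebra.intro symmetric_partial_module_algebra_axioms.intro)
  fix \<omega> b :: "('g, 'k) AG_dual" and x y :: 'r
  show "hopf_algebra (dual_scale :: 'k \<Rightarrow> ('g, 'k) AG_dual \<Rightarrow> _) dual_comult dual_counit dual_antipode"
    by (rule dual_hopf_algebra)
  show "assoc_algebra scale" by (rule assoc_algebra_axioms)
  show "bij (dual_antipode :: ('g, 'k) AG_dual \<Rightarrow> _)" by (rule dual_antipode_bij)
  show "nondegenerate (UNIV :: 'r set)" by (rule nondegenerate)
  show "Vector_Spaces.linear dual_scale scale (\<lambda>\<omega>. act \<omega> x)" by (rule act_linear_left)
  show "Vector_Spaces.linear scale scale (act \<omega>)"
    by (simp add: Vector_Spaces.linear_iff vector_space_axioms act_right)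
  have "proj \<omega> x * y = x * proj \<omega> y" for x y
    by (simp add: proj_def dual_extend_def sum_distrib_left sum_distrib_right p_balanced
        scale_mult_left[symmetric] scale_mult_right[symmetric])
  then show "(proj \<omega>, proj \<omega>) \<in> multipliers scale UNIV"
    by (simp add: multipliers_def linear_on_def proj_right)
  show "Vector_Spaces.linear dual_scale scale (\<lambda>\<omega>. mult_left (proj \<omega>, proj \<omega>) x)"
    "Vector_Spaces.linear dual_scale scale (\<lambda>\<omega>. mult_right x (proj \<omega>, proj \<omega>))"
    by (simp_all add: proj_linear_left)
  \<comment> \<open>Here and in the next three equations the first simplification collapses each
    summand to one group-like, and the second recognises the sum as a linear extension.\<close>
  show "act \<omega> (x * act b y) = (\<Sum>(a1, a2)\<in>dual_comult \<omega>. act a1 x * act (a2 * b) y)"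
    by (simp add: sum_dual_comult act_left act_phi_delta scale_mult_left[symmetric]
        a_mult_act[symmetric]) (simp add: act_def dual_extend_def)
  show "act \<omega> (act b x * y) = (\<Sum>(a1, a2)\<in>dual_comult \<omega>. act (a1 * b) x * act a2 y)"
    by (simp add: sum_dual_comult act_left act_phi_delta scale_mult_left[symmetric]
        dual.scale_mult_left[symmetric] a_act_mult[symmetric]) (simp add: act_def dual_extend_def)
  show "mult_left (proj \<omega>, proj \<omega>) (act b x) =
      (\<Sum>(a1, a2)\<in>dual_comult \<omega>. act a1 (act (dual_antipode a2 * b) x))"
    by (simp add: sum_dual_comult act_left act_phi_delta dual_antipode_phi_delta a_act_inverse)
      (simp add: proj_def dual_extend_def)
  show "mult_right (act b x) (proj \<omega>, proj \<omega>) =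
      (\<Sum>(a1, a2)\<in>dual_comult \<omega>. act a2 (act (inv dual_antipode a1 * b) x))"
    by (simp add: sum_dual_comult act_left act_phi_delta inv_dual_antipode_phi_delta
        inv_dual_antipode_scale dual.scale_mult_left[symmetric] a_scale a_act_inverse)
      (simp add: proj_def dual_extend_def)
  \<comment> \<open>Since \<open>1\<close> acts as the identity, this span is the whole
    algebra.\<close>
  have "x \<in> span {act \<omega> x | \<omega> x. True}" for x
    by (rule span_base) (metis (mono_tags, lifting) act_one mem_Collect_eq)
  then show "span {mult_left (proj \<omega>, proj \<omega>) x | \<omega> x. True} \<subseteq> span {act \<omega> x | \<omega> x. True}"
    "span {mult_right x (proj \<omega>, proj \<omega>) | \<omega> x. True} \<subseteq> span {act \<omega> x | \<omega> x. True}"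
    by blast+
  show "(\<forall>\<omega>. act \<omega> x = 0) \<longleftrightarrow> x = 0" using act_one[of x] act_zero(2) by metis
next
  fix P :: "('g, 'k) AG_dual set" and Q :: "'r set"
  show "\<exists>b. (\<forall>\<omega>\<in>P. \<omega> * b = \<omega> \<and> b * \<omega> = \<omega>) \<and> (\<forall>\<omega>\<in>P. \<forall>x\<in>Q. act \<omega> x = act \<omega> (act b x))"
    by (rule exI[of _ 1]) (simp add: act_one)
qed

end


section \<open>Central multipliers\<close>

text \<open>Commuting \<open>m\<close> with the inner multiplier of \<open>x\<close> gives m(xb) =
  x(mb). The left side is (mx)b and the right side is (xm)b, so nondegeneracy gives mx = xm.\<close>

lemma central_multiplier_left_eq_right:
  fixes scale :: "'k::field \<Rightarrow> 'r::ring \<Rightarrow> 'r"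
  assumes "assoc_algebra scale" and nd: "nondegenerate (UNIV :: 'r set)"
    and "central_idempotent_multiplier scale UNIV m"
  shows "fst m x = snd m x"
proof -
  interpret assoc_algebra scale by fact
  have m: "m \<in> multipliers scale UNIV"
    and central: "\<And>n. n \<in> multipliers scale UNIV \<Longrightarrow>
      multiplier_prod UNIV m n = multiplier_prod UNIV n m"
    using assms(3) by (auto simp: central_idempotent_multiplier_def)
  have inner: "inner_multiplier UNIV x \<in> multipliers scale UNIV"
    by (auto simp: inner_multiplier_def multipliers_def linear_on_def mult.assoc
        distrib_left distrib_right scale_mult_left[symmetric] scale_mult_right[symmetric])
  have "(fst m x - snd m x) * b = 0" for b
  proof -
    have "fst m x * b = fst m (x * b)" using multiplier_mult(1)[OF m nd] by simp
    also have "\<dots> = x * fst m b"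
      using fun_cong[OF arg_cong[OF central[OF inner], of fst], of b]
      by (simp add: multiplier_prod_def compose_def inner_multiplier_def)
    also have "\<dots> = snd m x * b" using m by (auto simp: multipliers_def)
    finally show ?thesis by (simp add: left_diff_distrib)
  qed
  then show ?thesis using nd unfolding nondegenerate_def by (metis UNIV_I eq_iff_diff_eq_0)
qed

section \<open>From the multipliers \<sigma> to a multiplicative partial representation\<close>

theorem theorem3p32:
  fixes scale :: "'k::field \<Rightarrow> 'r::ring \<Rightarrow> 'r"
    and D :: "'g::group_add \<Rightarrow> 'r set"
    and \<alpha> :: "'g \<Rightarrow> 'r \<Rightarrow> 'r"
    and \<sigma> :: "'g \<Rightarrow> 'r multiplier"
  assumes "assoc_algebra scale"
    and "left_s_unital (UNIV :: 'r set)"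
    and "nondegenerate (UNIV :: 'r set)"
    and "partial_action scale D \<alpha>"
    and "globalizable TYPE('t::ring) scale D \<alpha>"
    and "\<And>g. nondegenerate (D g)"
    and "\<And>g. \<sigma> g \<in> multipliers scale UNIV"
    and "\<And>g. central_idempotent_multiplier scale UNIV (\<sigma> g)"
    and "\<And>g h. extend_to_multipliers (D (- g)) (D g) (\<alpha> g)
           (restrict_multiplier (D (- g)) (multiplier_prod UNIV (\<sigma> (- g)) (\<sigma> h))) =
         restrict_multiplier (D g) (multiplier_prod UNIV (\<sigma> g) (\<sigma> (g + h)))"
    and "\<And>g x. x \<in> D (- g) \<Longrightarrow> \<alpha> g x = mult_right (\<alpha> g x) (\<sigma> g)"
    and "\<And>g. {mult_right x (\<sigma> g) | x. True} \<subseteq> D g"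
  shows "\<exists>(act :: ('g, 'k) AG_dual \<Rightarrow> 'r \<Rightarrow> 'r) (\<ee> :: ('g, 'k) AG_dual \<Rightarrow> 'r multiplier).
    symmetric_partial_module_algebra dual_scale dual_comult dual_counit dual_antipode scale act \<ee> \<and>
    (\<forall>g x. act (phi_delta g) x = \<alpha> g (mult_right x (\<sigma> (- g)))) \<and>
    (\<forall>g. \<ee> (phi_delta g) = \<sigma> g)"
proof -
  interpret partial_action scale D \<alpha> by fact
  define p where "p g = snd (\<sigma> g)" for g
  define a where "a g x = \<alpha> g (p (- g) x)" for g x
  note nd = assms(3) and \<sigma> = assms(7)
  have p_left: "fst (\<sigma> g) = p g" for g
    using central_multiplier_left_eq_right[OF assms(1) nd assms(8)] by (auto simp: p_def)
  have p_add: "p g (x + y) = p g x + p g y" and p_scale: "p g (scale c x) = scale c (p g x)"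
    and p_balanced: "p g x * y = x * p g y" for g x y c
    using \<sigma>[of g] p_left[of g] by (auto simp: multipliers_def linear_on_def p_def)
  have p_mult: "p g (x * y) = x * p g y" for g x y
    using multiplier_mult(2)[OF \<sigma> nd] by (simp add: p_def)
  have p_idem: "p g (p g x) = p g x" for g x
  proof -
    have "multiplier_prod UNIV (\<sigma> g) (\<sigma> g) = \<sigma> g"
      using assms(8) by (simp add: central_idempotent_multiplier_def)
    from fun_cong[OF arg_cong[OF this, of snd], of x] show ?thesis
      by (simp add: multiplier_prod_def compose_def p_def)
  qed
  have p_commute: "p g (p h x) = p h (p g x)" for g h x
  proof -
    have "multiplier_prod UNIV (\<sigma> h) (\<sigma> g) = multiplier_prod UNIV (\<sigma> g) (\<sigma> h)"
      using assms(8)[of h] \<sigma>[of g] by (simp add: central_idempotent_multiplier_def)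
    from fun_cong[OF arg_cong[OF this, of snd], of x] show ?thesis
      by (simp add: multiplier_prod_def compose_def p_def)
  qed
  have p_mem: "p g x \<in> D g" for g x using assms(11)[of g] by (auto simp: p_def)
  have bij: "bij_betw (\<alpha> g) (D (- g)) (D g)" for g
    using iso[of g] by (simp add: algebra_iso_on_def)
  \<comment> \<open>Every element of \<open>D g\<close> is a value of \<open>\<alpha> g\<close>, and
    hypothesis (iii) says that \<open>p g\<close> fixes those values. With \<open>p_mem\<close>,
    \<open>D g\<close> is the image of \<open>p g\<close>.\<close>
  have p_fix: "p g y = y" if "y \<in> D g" for g y
  proof -
    have "y \<in> \<alpha> g ` D (- g)" using bij[of g] that by (simp add: bij_betw_def)
    then show ?thesis by (auto simp: p_def assms(10)[symmetric])
  qed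
  \<comment> \<open>Hypothesis (ii) evaluated from the right at \<open>\<alpha> g x\<close>; the
    factors \<open>p (- g)\<close> and \<open>p g\<close> disappear because they fix
    \<open>x\<close> and \<open>\<alpha> g x\<close>.\<close>
  have \<alpha>_p: "\<alpha> g (p h x) = p (g + h) (\<alpha> g x)" if x: "x \<in> D (- g)" for g h x
  proof -
    have \<alpha>x: "\<alpha> g x \<in> D g" using bij[of g] x by (auto simp: bij_betw_def)
    have inv: "inv_into (D (- g)) (\<alpha> g) (\<alpha> g x) = x"
      using bij[of g] x by (simp add: bij_betw_def)
    show ?thesis using fun_cong[OF arg_cong[OF assms(9)[of g h], of snd], of "\<alpha> g x"] x \<alpha>x
      by (simp add: extend_to_multipliers_def restrict_multiplier_def multiplier_prod_def
          compose_def inv p_def[symmetric] p_fix)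
  qed
  have hom: "algebra_hom_on scale scale (D (- g)) (\<alpha> g)" for g
    using iso[of g] by (simp add: algebra_iso_on_def)
  have a_p: "a g (p h x) = p (g + h) (a g x)" for g h x
    unfolding a_def p_commute[of "- g"] by (rule \<alpha>_p) (rule p_mem)
  have a_mem: "a g x \<in> D g" for g x
    unfolding a_def using bij[of g] p_mem[of "- g" x] by (auto simp: bij_betw_def)
  interpret multiplicative_partial_representation scale a p
  proof (intro multiplicative_partial_representation.intro
      multiplicative_partial_representation_axioms.intro)
    fix g h x y
    show "assoc_algebra scale" by (rule assms(1))
    show "nondegenerate (UNIV :: 'r set)" by (rule nd)
    show "Vector_Spaces.linear scale scale (p g)"
      by (simp add: Vector_Spaces.linear_iff vector_space_axioms p_add p_scale)
    show "Vector_Spaces.linear scale scale (a g)"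
      using hom[of g] p_mem[of "- g"]
      by (simp add: Vector_Spaces.linear_iff vector_space_axioms a_def p_add p_scale
          algebra_hom_on_def linear_on_def)
    show "a 0 x = x" by (simp add: a_def act_unit p_fix dom_unit)
    have "p (- g) (x * y) = p (- g) x * p (- g) y"
      by (simp add: p_mult p_balanced p_idem)
    then show "a g (x * y) = a g x * a g y"
      using hom[of g] p_mem[of "- g"] by (simp add: a_def algebra_hom_on_def)
    show "p g (a g x) = a g x" by (rule p_fix) (rule a_mem)
    show "p g x * y = x * p g y" by (rule p_balanced)
    \<comment> \<open>\<open>act_comp\<close> needs an argument that \<open>\<alpha> h\<close> sends
      into \<open>D (- g)\<close>. The extra projection ensures this: \<open>\<alpha> h\<close>
      carries \<open>p (- (g + h))\<close> to \<open>p (- g)\<close>, so \<open>\<alpha> h z\<close>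
      is \<open>p (- g) (a h x)\<close>, the very argument of \<open>\<alpha> g\<close> in
      \<open>a g (a h x)\<close>.\<close>
    define z where "z = p (- (g + h)) (p (- h) x)"
    have z: "z \<in> D (- h)"
      unfolding z_def p_commute[of "- (g + h)"] by (rule p_mem)
    have "\<alpha> h z = p (- g) (a h x)"
      unfolding z_def a_def by (subst \<alpha>_p[OF p_mem])
        (simp add: minus_add del: add_uminus_conv_diff)
    moreover have "\<alpha> h z \<in> D h" using bij[of h] z by (auto simp: bij_betw_def)
    ultimately have "\<alpha> h z \<in> D h \<inter> D (- g)" using p_mem by simp
    moreover have "z = inv_into (D (- h)) (\<alpha> h) (\<alpha> h z)"
      using bij[of h] z by (simp add: bij_betw_def)
    ultimately have "\<alpha> g (\<alpha> h z) = \<alpha> (g + h) z" by (intro act_comp) blast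
    then have "a g (a h x) = a (g + h) (p (- h) x)"
      using \<open>\<alpha> h z = p (- g) (a h x)\<close> by (simp add: a_def z_def)
    \<comment> \<open>Moving \<open>p (- h)\<close> out through \<open>a (g + h)\<close> shifts its
      index to \<open>g + h - h = g\<close>.\<close>
    also have "\<dots> = p g (a (g + h) x)" by (simp add: a_p add.assoc)
    finally show "a g (a h x) = p g (a (g + h) x)" .
  qed
  have "(proj (phi_delta g), proj (phi_delta g)) = \<sigma> g" for g
    using p_left[of g] by (simp add: prod_eq_iff fun_eq_iff proj_phi_delta p_def)
  moreover have "act (phi_delta g) x = \<alpha> g (mult_right x (\<sigma> (- g)))" for g x
    by (simp add: act_phi_delta a_def p_def)
  ultimately show ?thesis
    by (intro exI[of _ act] exI[of _ "\<lambda>\<omega>. (proj \<omega>, proj \<omega>)"] conjI allI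
        symmetric_partial_module_algebra)
qed

end
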